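(* Let $ABC$ be a triangle with complement map $K$ and with midpoints $D_0,E_0,F_0$ of $BC,CA,AB$. Let $\overline{\mathcal{C}}_A$ be the conic through $B,C,E_0,F_0$ whose tangents at $B$ and $C$ are $K^{-1}(AC)$ and $K^{-1}(AB)$; let $\overline{\mathcal{C}}_B$ be the conic through $C,A,F_0,D_0$ whose tangents at $C$ and $A$ are $K^{-1}(BA)$ and $K^{-1}(BC)$; and let $\overline{\mathcal{C}}_C$ be the conic through $A,B,D_0,E_0$ whose tangents at $A$ and $B$ are $K^{-1}(CB)$ and $K^{-1}(CA)$. The locus of points $P$ for which the generalized orthocenter $H$ of $P$ is (defined and) a vertex of $ABC$ is $$(\overline{\mathcal{C}}_A\cup\overline{\mathcal{C}}_B\cup\overline{\mathcal{C}}_C)\setminus\{A,B,C,D_0,E_0,F_0\}.$$ Moreover, each of these three conics is tangent to the Steiner circumellipse $\iota(l_\infty)$ of $ABC$ at two of the vertices ($\overline{\mathcal{C}}_A$ at $B$ and $C$, and similarly for the others), and, except for the points $A,B,C$, the three conics lie in the interior of the Steiner circumellipse.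
   Context: Work in the extended Euclidean plane (the Euclidean plane together with the line at infinity $l_\infty$). $ABC$ is an ordinary (non-degenerate) triangle with centroid $G$. The complement map $K$ is the homothety with center $G$ and ratio $-1/2$ (it fixes $l_\infty$ pointwise); $K^{-1}(ABC)$ is the anticomplementary triangle. The isotomic map $\iota$ with respect to $ABC$ is given in homogeneous barycentric coordinates by $(x,y,z)\mapsto(1/x,1/y,1/z)$. The Steiner circumellipse $\iota(l_\infty)$ is the conic $xy+yz+zx=0$ in homogeneous barycentric coordinates. The generalized orthocenter $H$ is defined for points $P$ not lying on the extended sides of $ABC$ or of $K^{-1}(ABC)$. For such $P$ put $P'=\iota(P)$, $Q=K(P')$, and let $D=AP\cap BC$, $E=BP\cap CA$, $F=CP\cap AB$ be the traces of $P$, and $D_3,E_3,F_3$ the traces of $P'$ on $BC,CA,AB$. Then $H$ is the unique point such that the lines $HA,HB,HC$ are parallel to $QD,QE,QF$, respectively (when $H$ coincides with a vertex the corresponding condition is void). Equivalently, $H=K^{-1}\circ T_{P'}^{-1}\circ K(Q)$, where $T_{P'}$ is the unique affine map taking $A,B,C$ to $D_3,E_3,F_3$, respectively. *)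

theory Defs
  imports "HOL-Analysis.Analysis"
begin

text \<open>The extended Euclidean plane: its points are the lines through the origin of
  \<open>real^3\<close>; an ordinary point \<open>p\<close> is spanned by \<open>(p, 1)\<close>.\<close>

typedef ext_point = "{L :: (real^3) set. subspace L \<and> dim L = 1}"
  morphisms span_of ext_point_of
proof -
  have "dim (span {axis 1 1 :: real^3}) = 1"
    by (simp add: dim_eq_card_independent axis_eq_0_iff dim_span)
  then show ?thesis
    by (auto intro!: exI[of _ "span {axis 1 1}"])
qed

definition lift :: "real^2 \<Rightarrow> real^3" where
  "lift p = vector [p $ 1, p $ 2, 1]"

definition pt :: "real^2 \<Rightarrow> ext_point" where
  "pt p = ext_point_of (span {lift p})"

definition l_inf :: "ext_point set" where
  "l_inf = {X. \<forall>v \<in> span_of X. v $ 3 = 0}"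

text \<open>Lines are identified with their sets of points. The join is a line only for distinct points,
  and the meet is meaningful only for distinct lines.\<close>

definition line_join :: "ext_point \<Rightarrow> ext_point \<Rightarrow> ext_point set" where
  "line_join X Y = {Z. span_of Z \<subseteq> span (span_of X \<union> span_of Y)}"

definition line_meet :: "ext_point set \<Rightarrow> ext_point set \<Rightarrow> ext_point" where
  "line_meet l m = (THE X. X \<in> l \<and> X \<in> m)"

definition parallel_lines :: "ext_point set \<Rightarrow> ext_point set \<Rightarrow> bool" where
  "parallel_lines l m \<longleftrightarrow> l \<noteq> l_inf \<and> m \<noteq> l_inf \<and> l \<inter> l_inf = m \<inter> l_inf"

text \<open>Conics are taken to be nondegenerate with real points: the nonempty set of
  self-conjugate points of a polarity, given by an invertible symmetric matrix.
  The tangent at a point of the conic is the polar of that point.\<close>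

definition polarity :: "real^3^3 \<Rightarrow> bool" where
  "polarity M \<longleftrightarrow> transpose M = M \<and> det M \<noteq> 0"

definition polar :: "real^3^3 \<Rightarrow> ext_point \<Rightarrow> ext_point set" where
  "polar M X = {Y. \<forall>u \<in> span_of X. \<forall>v \<in> span_of Y. u \<bullet> (M *v v) = 0}"

definition self_conjugate :: "real^3^3 \<Rightarrow> ext_point set" where
  "self_conjugate M = {X. X \<in> polar M X}"

definition is_conic :: "ext_point set \<Rightarrow> bool" where
  "is_conic S \<longleftrightarrow> S \<noteq> {} \<and> (\<exists>M. polarity M \<and> S = self_conjugate M)"

definition tangent_line :: "ext_point set \<Rightarrow> ext_point \<Rightarrow> ext_point set \<Rightarrow> bool" where
  "tangent_line S X l \<longleftrightarrow>
     X \<in> S \<and> (\<exists>M. polarity M \<and> S = self_conjugate M \<and> l = polar M X)"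

definition conics_tangent_at :: "ext_point set \<Rightarrow> ext_point set \<Rightarrow> ext_point \<Rightarrow> bool" where
  "conics_tangent_at S T X \<longleftrightarrow>
     is_conic S \<and> is_conic T \<and> (\<exists>l. tangent_line S X l \<and> tangent_line T X l)"

text \<open>For an ellipse, \<open>inside\<close> is the bounded component of its complement in the Euclidean plane.\<close>

definition ellipse_interior :: "ext_point set \<Rightarrow> ext_point set" where
  "ellipse_interior S = pt ` inside (pt -` S)"

text \<open>Homogeneous barycentric coordinates with respect to \<open>ABC\<close>; meaningful for
  \<open>(x, y, z) \<noteq> (0, 0, 0)\<close> only.\<close>

definition bary :: "real^2 \<Rightarrow> real^2 \<Rightarrow> real^2 \<Rightarrow> real \<Rightarrow> real \<Rightarrow> real \<Rightarrow> ext_point" where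
  "bary A B C x y z =
     ext_point_of (span {x *\<^sub>R lift A + y *\<^sub>R lift B + z *\<^sub>R lift C})"

definition isotomic :: "real^2 \<Rightarrow> real^2 \<Rightarrow> real^2 \<Rightarrow> ext_point \<Rightarrow> ext_point" where
  "isotomic A B C X =
     (THE Y. \<exists>x y z. x \<noteq> 0 \<and> y \<noteq> 0 \<and> z \<noteq> 0 \<and>
        X = bary A B C x y z \<and> Y = bary A B C (1 / x) (1 / y) (1 / z))"

definition steiner_circumellipse :: "real^2 \<Rightarrow> real^2 \<Rightarrow> real^2 \<Rightarrow> ext_point set" where
  "steiner_circumellipse A B C =
     {bary A B C x y z | x y z. (x, y, z) \<noteq> (0, 0, 0) \<and> x * y + y * z + z * x = 0}"

definition centroid :: "real^2 \<Rightarrow> real^2 \<Rightarrow> real^2 \<Rightarrow> real^2" where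
  "centroid A B C = (1 / 3) *\<^sub>R (A + B + C)"

definition complement :: "real^2 \<Rightarrow> real^2 \<Rightarrow> real^2 \<Rightarrow> ext_point \<Rightarrow> ext_point" where
  "complement A B C X =
     (if X \<in> l_inf then X
      else (let p = (THE p. pt p = X); G = centroid A B C in pt (G + (- 1 / 2) *\<^sub>R (p - G))))"

text \<open>\<open>anticomplement\<close> is \<open>K\<^sup>-\<^sup>1\<close> applied to a set of points; \<open>K\<close> is bijective, so it is the preimage.\<close>

definition anticomplement :: "real^2 \<Rightarrow> real^2 \<Rightarrow> real^2 \<Rightarrow> ext_point set \<Rightarrow> ext_point set" where
  "anticomplement A B C l = complement A B C -` l"

definition side_lines :: "real^2 \<Rightarrow> real^2 \<Rightarrow> real^2 \<Rightarrow> ext_point set" where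
  "side_lines A B C =
     line_join (pt B) (pt C) \<union> line_join (pt C) (pt A) \<union> line_join (pt A) (pt B)"

definition has_gen_orthocenter :: "real^2 \<Rightarrow> real^2 \<Rightarrow> real^2 \<Rightarrow> ext_point \<Rightarrow> bool" where
  "has_gen_orthocenter A B C P \<longleftrightarrow>
     P \<notin> side_lines A B C \<and> P \<notin> anticomplement A B C (side_lines A B C)"

definition gen_orthocenter :: "real^2 \<Rightarrow> real^2 \<Rightarrow> real^2 \<Rightarrow> ext_point \<Rightarrow> ext_point" where
  "gen_orthocenter A B C P =
     (let Q = complement A B C (isotomic A B C P);
          D = line_meet (line_join (pt A) P) (line_join (pt B) (pt C));
          E = line_meet (line_join (pt B) P) (line_join (pt C) (pt A));
          F = line_meet (line_join (pt C) P) (line_join (pt A) (pt B))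
      in THE H.
          (H = pt A \<or> parallel_lines (line_join H (pt A)) (line_join Q D)) \<and>
          (H = pt B \<or> parallel_lines (line_join H (pt B)) (line_join Q E)) \<and>
          (H = pt C \<or> parallel_lines (line_join H (pt C)) (line_join Q F)))"

text \<open>The property defining the conic attached to the first vertex \<open>A\<close>; the conics
  attached to \<open>B\<close> and \<open>C\<close> arise by cyclic permutation of the arguments.\<close>

definition is_vertex_conic :: "real^2 \<Rightarrow> real^2 \<Rightarrow> real^2 \<Rightarrow> ext_point set \<Rightarrow> bool" where
  "is_vertex_conic A B C S \<longleftrightarrow>
     is_conic S \<and>
     {pt B, pt C, pt (midpoint C A), pt (midpoint A B)} \<subseteq> S \<and>
     tangent_line S (pt B) (anticomplement A B C (line_join (pt A) (pt C))) \<and>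
     tangent_line S (pt C) (anticomplement A B C (line_join (pt A) (pt B)))"

definition vertex_conic :: "real^2 \<Rightarrow> real^2 \<Rightarrow> real^2 \<Rightarrow> ext_point set" where
  "vertex_conic A B C = (THE S. is_vertex_conic A B C S)"

end

theory Submission
  imports Defs
begin

text \<open>
  Work in homogeneous barycentric coordinates with respect to \<open>ABC\<close>, let \<open>P = (x, y, z)\<close> and put
  \<open>s = x y + y z + z x\<close>. For admissible \<open>P\<close> one finds \<open>Q = (x (y + z), y (z + x), z (x + y))\<close> and
  \<open>D = (0, y, z)\<close>, and \<open>QD\<close> has the point at infinity
  \<open>(x (y + z)\<^sup>2, y (z\<^sup>2 - s), z (y\<^sup>2 - s))\<close>. The condition that \<open>H = (u, v, w)\<close> equals \<open>A\<close> or that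
  \<open>HA\<close> is parallel to \<open>QD\<close> is therefore the single linear equation
  \<open>v z (y\<^sup>2 - s) = w y (z\<^sup>2 - s)\<close> (\<open>parallel_to_vertex_iff\<close>), and the other two follow cyclically.
  With \<open>a = x\<^sup>2 - s\<close>, \<open>b = y\<^sup>2 - s\<close>, \<open>c = z\<^sup>2 - s\<close> the three equations are solved by
  \<open>H = (x b c, y c a, z a b)\<close>, and by this point only, because no two of \<open>a\<close>, \<open>b\<close>, \<open>c\<close> vanish
  (\<open>gen_orthocenter_bary\<close>). Hence \<open>H = A\<close> exactly when \<open>x\<^sup>2 = s\<close>, which is the equation of a
  conic, and the points of that conic where \<open>H\<close> is not defined are \<open>B\<close>, \<open>C\<close> and two midpoints
  (\<open>vertex_locus\<close>).

  The four incidences and the tangent at \<open>B\<close> determine the matrix of a vertex conic up to a factor,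
  and the equation they give is again \<open>x\<^sup>2 = s\<close> (\<open>is_vertex_conic_iff\<close>). The Steiner circumellipse is
  \<open>s = 0\<close>; both conics have the tangents \<open>x + z = 0\<close> at \<open>B\<close> and \<open>x + y = 0\<close> at \<open>C\<close>. Finally
  \<open>s = x\<^sup>2 > 0\<close> on the vertex conic away from \<open>B\<close> and \<open>C\<close>, and \<open>s > 0\<close> describes the interior of
  the ellipse (\<open>in_steiner_interior\<close>). The statements for the other two vertices are obtained by
  applying those for \<open>A\<close> to the triangles \<open>BCA\<close> and \<open>CAB\<close>.
\<close>

section \<open>Points of the extended plane and their spanning vectors\<close>

lemma span_of_span:
  assumes "v \<noteq> 0" shows "span_of (ext_point_of (span {v})) = span {v}"
proof (rule ext_point_of_inverse)
  show "span {v} \<in> {L. subspace L \<and> dim L = 1}"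
    using assms by (simp add: dim_eq_card_independent)
qed

lemma ext_point_spanned:
  obtains v where "v \<noteq> 0" "X = ext_point_of (span {v})"
proof -
  have L: "subspace (span_of X)" "dim (span_of X) = 1" using span_of[of X] by auto
  then have "span_of X \<noteq> {0}" by (metis dim_singleton zero_neq_one)
  then obtain v where v: "v \<in> span_of X" "v \<noteq> 0"
    using subspace_0[OF L(1)] by blast
  have "span {v} = span (span_of X)"
    by (rule dim_eq_span) (use v L in \<open>auto simp: dim_eq_card_independent\<close>)
  then have "span {v} = span_of X" using L(1) by (simp add: span_eq_iff)
  then show ?thesis using that v(2) by (metis span_of_inverse)
qed

lemma ext_point_of_eq_iff:
  assumes "u \<noteq> 0" "v \<noteq> 0"
  shows "ext_point_of (span {u}) = ext_point_of (span {v}) \<longleftrightarrow> (\<exists>c. u = c *\<^sub>R v)"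
proof
  assume "ext_point_of (span {u}) = ext_point_of (span {v})"
  then have "span {u} = span {v}" using assms span_of_span by metis
  then have "u \<in> span {v}" using span_base[of u "{u}"] by simp
  then show "\<exists>c. u = c *\<^sub>R v" by (auto simp: span_singleton)
next
  assume "\<exists>c. u = c *\<^sub>R v"
  then obtain c where c: "u = c *\<^sub>R v" by blast
  then have "c \<noteq> 0" using assms by auto
  then have "span {u} = span {v}" using c span_image_scale[of "{v}" "\<lambda>_. c"] by simp
  then show "ext_point_of (span {u}) = ext_point_of (span {v})" by simp
qed

lemma in_line_join_iff:
  assumes "u \<noteq> 0" "v \<noteq> 0" "w \<noteq> 0"
  shows "ext_point_of (span {w}) \<in> line_join (ext_point_of (span {u})) (ext_point_of (span {v}))
    \<longleftrightarrow> (\<exists>a b. w = a *\<^sub>R u + b *\<^sub>R v)"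
proof -
  have "span (span {u} \<union> span {v}) \<subseteq> span {u, v}"
    by (intro span_minimal Un_least span_mono subspace_span) auto
  moreover have "span {u, v} \<subseteq> span (span {u} \<union> span {v})"
    by (intro span_mono) (auto intro: span_base)
  ultimately have e: "span (span {u} \<union> span {v}) = span {u, v}" by blast
  have "span {w} \<subseteq> span {u, v} \<longleftrightarrow> w \<in> span {u, v}"
    using span_base[of w "{w}"] span_minimal[of "{w}" "span {u, v}"] by auto
  also have "\<dots> \<longleftrightarrow> (\<exists>a b. w = a *\<^sub>R u + b *\<^sub>R v)"
    unfolding span_insert span_singleton by (auto simp: diff_eq_eq add.commute)
  finally show ?thesis using assms by (simp add: line_join_def span_of_span e)
qed

lemma in_polar_iff:
  assumes "u \<noteq> 0" "v \<noteq> 0"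
  shows "ext_point_of (span {v}) \<in> polar M (ext_point_of (span {u})) \<longleftrightarrow> u \<bullet> (M *v v) = 0"
proof
  assume "ext_point_of (span {v}) \<in> polar M (ext_point_of (span {u}))"
  then show "u \<bullet> (M *v v) = 0"
    using assms by (simp add: polar_def span_of_span span_base)
next
  assume "u \<bullet> (M *v v) = 0"
  then show "ext_point_of (span {v}) \<in> polar M (ext_point_of (span {u}))"
    using assms by (simp add: polar_def span_of_span) (auto simp: span_singleton matrix_vector_mult_scaleR)
qed

lemma in_l_inf_iff:
  assumes "v \<noteq> 0" shows "ext_point_of (span {v}) \<in> l_inf \<longleftrightarrow> v $ 3 = 0"
proof
  assume "ext_point_of (span {v}) \<in> l_inf"
  then show "v $ 3 = 0" using assms by (simp add: l_inf_def span_of_span span_base)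
next
  assume "v $ 3 = 0"
  then show "ext_point_of (span {v}) \<in> l_inf"
    using assms by (simp add: l_inf_def span_of_span) (auto simp: span_singleton)
qed

lemma line_join_commute: "line_join X Y = line_join Y X"
  by (simp add: line_join_def Un_commute)

lemma conics_tangent_atI:
  assumes M: "polarity M" "S = self_conjugate M" and N: "polarity N" "T = self_conjugate N"
    and "X \<in> S" "X \<in> T" and tangent: "polar M X = polar N X"
  shows "conics_tangent_at S T X"
proof -
  have "is_conic S" "is_conic T" unfolding is_conic_def using assms by blast+
  moreover have "tangent_line S X (polar M X)" "tangent_line T X (polar N X)"
    unfolding tangent_line_def using assms by blast+
  ultimately show ?thesis unfolding conics_tangent_at_def tangent by blast
qed

lemma lift_nth [simp]: "lift p $ 1 = p $ 1" "lift p $ 2 = p $ 2" "lift p $ 3 = 1"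
  by (simp_all add: lift_def vector_3)

lemma pt_inj: "pt p = pt q \<longleftrightarrow> p = q"
proof
  assume "pt p = pt q"
  moreover have "lift r \<noteq> 0" for r by (metis lift_nth(3) zero_index zero_neq_one)
  ultimately obtain c where "lift p = c *\<^sub>R lift q" by (auto simp: pt_def ext_point_of_eq_iff)
  moreover from this have "c = 1"
    by (metis lift_nth(3) mult.right_neutral real_scaleR_def vector_scaleR_component)
  ultimately have "lift p = lift q" by simp
  then have "lift p $ 1 = lift q $ 1" "lift p $ 2 = lift q $ 2" by simp_all
  then show "p = q" by (simp add: vec_eq_iff forall_2)
qed simp

lemma collinear_if_det_zero:
  assumes "(B $ 1 - A $ 1) * (C $ 2 - A $ 2) = (B $ 2 - A $ 2) * (C $ 1 - A $ 1)"
  shows "collinear {A, B, C :: real^2}"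
proof -
  have "collinear {0, B - A, C - A}"
  proof (cases "B = A")
    case True then show ?thesis by simp
  next
    case False
    then have "B $ 1 - A $ 1 \<noteq> 0 \<or> B $ 2 - A $ 2 \<noteq> 0" by (auto simp: vec_eq_iff forall_2)
    then show ?thesis unfolding collinear_lemma
    proof
      assume "B $ 1 - A $ 1 \<noteq> 0"
      then have "C - A = ((C $ 1 - A $ 1) / (B $ 1 - A $ 1)) *\<^sub>R (B - A)"
        using assms by (simp add: vec_eq_iff forall_2 eq_divide_eq mult.commute)
      then show "B - A = 0 \<or> C - A = 0 \<or> (\<exists>c. C - A = c *\<^sub>R (B - A))" by blast
    next
      assume "B $ 2 - A $ 2 \<noteq> 0"
      then have "C - A = ((C $ 2 - A $ 2) / (B $ 2 - A $ 2)) *\<^sub>R (B - A)"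
        using assms by (simp add: vec_eq_iff forall_2 eq_divide_eq mult.commute)
      then show "B - A = 0 \<or> C - A = 0 \<or> (\<exists>c. C - A = c *\<^sub>R (B - A))" by blast
    qed
  qed
  then have "collinear {B, A, C}" by (simp add: collinear_3)
  then show ?thesis by (simp add: insert_commute)
qed

definition frame :: "real^2 \<Rightarrow> real^2 \<Rightarrow> real^2 \<Rightarrow> real^3^3" where
  "frame A B C = transpose (vector [lift A, lift B, lift C])"

lemma frame_mult:
  "frame A B C *v v = v $ 1 *\<^sub>R lift A + v $ 2 *\<^sub>R lift B + v $ 3 *\<^sub>R lift C"
  by (simp add: frame_def vec_eq_iff matrix_vector_mult_def transpose_def sum_3 vector_3 mult.commute)

section \<open>Barycentric coordinates\<close>

text \<open>Proportionality is expressed by the vanishing of the cross product, so that equality of points turns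
  into polynomial identities in the coordinates.\<close>

lemma parallel_iff_cross:
  fixes x y z x' y' z' :: real
  assumes "(x', y', z') \<noteq> (0, 0, 0)"
  shows "(\<exists>c. x = c * x' \<and> y = c * y' \<and> z = c * z') \<longleftrightarrow>
    y * z' = z * y' \<and> z * x' = x * z' \<and> x * y' = y * x'"
proof
  assume "y * z' = z * y' \<and> z * x' = x * z' \<and> x * y' = y * x'"
  then have eqs: "y * z' = z * y'" "z * x' = x * z'" "x * y' = y * x'" by auto
  consider "x' \<noteq> 0" | "y' \<noteq> 0" | "z' \<noteq> 0" using assms by auto
  then show "\<exists>c. x = c * x' \<and> y = c * y' \<and> z = c * z'"
  proof cases
    case 1 then show ?thesis using eqs by (intro exI[of _ "x / x'"]) (simp add: eq_divide_eq)
  next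
    case 2 then show ?thesis using eqs by (intro exI[of _ "y / y'"]) (simp add: eq_divide_eq)
  next
    case 3 then show ?thesis using eqs by (intro exI[of _ "z / z'"]) (simp add: eq_divide_eq)
  qed
qed auto

lemma bary_cycle: "bary A B C x y z = bary B C A y z x"
  by (simp add: bary_def add.commute add.left_commute)

locale triangle =
  fixes A B C :: "real^2"
  assumes noncollinear: "\<not> collinear {A, B, C}"
begin

abbreviation comb :: "real \<Rightarrow> real \<Rightarrow> real \<Rightarrow> real^3" where
  "comb x y z \<equiv> x *\<^sub>R lift A + y *\<^sub>R lift B + z *\<^sub>R lift C"

lemma frame_inverse:
  obtains T' where "T' ** frame A B C = mat 1" "frame A B C ** T' = mat 1"
proof -
  have "det (frame A B C) \<noteq> 0"
    using noncollinear collinear_if_det_zero[of B A C]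
    by (auto simp: frame_def det_3 transpose_def vector_3 algebra_simps)
  then show ?thesis using that by (metis invertible_def invertible_det_nz)
qed

lemma comb_eq_iff: "comb x y z = comb x' y' z' \<longleftrightarrow> x = x' \<and> y = y' \<and> z = z'"
proof
  assume "comb x y z = comb x' y' z'"
  then have "frame A B C *v vector [x, y, z] = frame A B C *v vector [x', y', z']"
    by (simp add: frame_mult vector_3)
  then have "(vector [x, y, z] :: real^3) = vector [x', y', z']"
    by (metis frame_inverse matrix_vector_mul_assoc matrix_vector_mul_lid)
  then show "x = x' \<and> y = y' \<and> z = z'" by (metis vector_3)
qed simp

lemma comb_zero_iff: "comb x y z = 0 \<longleftrightarrow> x = 0 \<and> y = 0 \<and> z = 0"
  using comb_eq_iff[of x y z 0 0 0] by simp

lemma comb_exists: obtains x y z where "v = comb x y z"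
  by (metis frame_inverse frame_mult matrix_vector_mul_assoc matrix_vector_mul_lid)

abbreviation bar :: "real \<Rightarrow> real \<Rightarrow> real \<Rightarrow> ext_point" where
  "bar \<equiv> bary A B C"

lemma bary_exists: obtains x y z where "(x, y, z) \<noteq> (0, 0, 0)" "X = bar x y z"
proof -
  obtain v where v: "v \<noteq> 0" "X = ext_point_of (span {v})" by (rule ext_point_spanned)
  obtain x y z where xyz: "v = comb x y z" by (rule comb_exists)
  show ?thesis
    by (rule that[of x y z]) (use v xyz in \<open>auto simp: bary_def\<close>)
qed

text \<open>Every point has coordinates, so sets of points may be compared by their equations.\<close>

lemma bary_set_eqI:
  assumes "\<And>x y z. (x, y, z) \<noteq> (0, 0, 0) \<Longrightarrow> bar x y z \<in> S \<longleftrightarrow> bar x y z \<in> T"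
  shows "S = T"
proof (rule set_eqI)
  fix X
  obtain x y z where "(x, y, z) \<noteq> (0, 0, 0)" "X = bar x y z" by (rule bary_exists)
  then show "X \<in> S \<longleftrightarrow> X \<in> T" using assms by simp
qed

lemma bary_eq_iff:
  assumes "(x, y, z) \<noteq> (0, 0, 0)" "(x', y', z') \<noteq> (0, 0, 0)"
  shows "bar x y z = bar x' y' z' \<longleftrightarrow> y * z' = z * y' \<and> z * x' = x * z' \<and> x * y' = y * x'"
proof -
  have "comb x y z \<noteq> 0" "comb x' y' z' \<noteq> 0" using assms by (auto simp: comb_zero_iff)
  then have "bar x y z = bar x' y' z' \<longleftrightarrow> (\<exists>c. comb x y z = c *\<^sub>R comb x' y' z')"
    unfolding bary_def by (rule ext_point_of_eq_iff)
  also have "\<dots> \<longleftrightarrow> (\<exists>c. comb x y z = comb (c * x') (c * y') (c * z'))"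
    by (simp add: scaleR_right_distrib)
  finally show ?thesis using parallel_iff_cross[OF assms(2)] by (simp add: comb_eq_iff)
qed

definition bary_line :: "real \<Rightarrow> real \<Rightarrow> real \<Rightarrow> ext_point set" where
  "bary_line l m n = {bar x y z | x y z. (x, y, z) \<noteq> (0, 0, 0) \<and> l * x + m * y + n * z = 0}"

text \<open>A homogeneous condition does not depend on the choice of coordinates, so it can be read off from
  any of them; lines and conics given by equations are instances.\<close>

lemma in_bary_set_iff:
  assumes "(x, y, z) \<noteq> (0, 0, 0)"
    and "\<And>x y z c. \<Phi> x y z \<Longrightarrow> \<Phi> (c * x) (c * y) (c * z)"
  shows "bar x y z \<in> {bar x y z | x y z. (x, y, z) \<noteq> (0, 0, 0) \<and> \<Phi> x y z} \<longleftrightarrow> \<Phi> x y z"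
proof
  assume "bar x y z \<in> {bar x y z | x y z. (x, y, z) \<noteq> (0, 0, 0) \<and> \<Phi> x y z}"
  then obtain x' y' z' where e: "bar x y z = bar x' y' z'" "(x', y', z') \<noteq> (0, 0, 0)" "\<Phi> x' y' z'"
    by blast
  then obtain c where "x = c * x' \<and> y = c * y' \<and> z = c * z'"
    using e(1) unfolding bary_eq_iff[OF assms(1) e(2)] parallel_iff_cross[OF e(2), symmetric] by blast
  then show "\<Phi> x y z" using e assms(2) by simp
qed (use assms(1) in blast)

lemma in_bary_line_iff:
  assumes "(x, y, z) \<noteq> (0, 0, 0)"
  shows "bar x y z \<in> bary_line l m n \<longleftrightarrow> l * x + m * y + n * z = 0"
  unfolding bary_line_def
proof (rule in_bary_set_iff[OF assms])
  fix x y z c :: real assume "l * x + m * y + n * z = 0"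
  then have "c * (l * x + m * y + n * z) = 0" by simp
  then show "l * (c * x) + m * (c * y) + n * (c * z) = 0" by (simp add: algebra_simps)
qed

lemma in_steiner_iff:
  assumes "(x, y, z) \<noteq> (0, 0, 0)"
  shows "bar x y z \<in> steiner_circumellipse A B C \<longleftrightarrow> x * y + y * z + z * x = 0"
  unfolding steiner_circumellipse_def
proof (rule in_bary_set_iff[OF assms])
  fix x y z c :: real assume "x * y + y * z + z * x = 0"
  then have "c\<^sup>2 * (x * y + y * z + z * x) = 0" by simp
  then show "c * x * (c * y) + c * y * (c * z) + c * z * (c * x) = 0"
    by (simp add: algebra_simps power2_eq_square)
qed

text \<open>A vector orthogonal to a nonzero cross product is a combination of the two factors: whichever
  component of the product does not vanish serves as the denominator in Cramer's rule.\<close>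

lemma line_join_bary:
  assumes p: "(x, y, z) \<noteq> (0, 0, 0)" "(x', y', z') \<noteq> (0, 0, 0)"
    and n: "l = y * z' - z * y'" "m = z * x' - x * z'" "n = x * y' - y * x'"
    and ne: "(l, m, n) \<noteq> (0, 0, 0)"
  shows "line_join (bar x y z) (bar x' y' z') = bary_line l m n"
proof (rule bary_set_eqI)
  fix u v w :: real assume uvw: "(u, v, w) \<noteq> (0, 0, 0)"
  have "bar u v w \<in> line_join (bar x y z) (bar x' y' z')
      \<longleftrightarrow> (\<exists>a b. comb u v w = a *\<^sub>R comb x y z + b *\<^sub>R comb x' y' z')"
    unfolding bary_def by (rule in_line_join_iff) (use p uvw in \<open>auto simp: comb_zero_iff\<close>)
  also have "\<dots> \<longleftrightarrow>
      (\<exists>a b. comb u v w = comb (a * x + b * x') (a * y + b * y') (a * z + b * z'))"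
    by (simp add: algebra_simps)
  also have "\<dots> \<longleftrightarrow> (\<exists>a b. u = a * x + b * x' \<and> v = a * y + b * y' \<and> w = a * z + b * z')"
    by (simp only: comb_eq_iff)
  also have "\<dots> \<longleftrightarrow> l * u + m * v + n * w = 0"
  proof -
    have solve: "t = a / k * r + b / k * r'"
      if "k * t = a * r + b * r'" "k \<noteq> 0" for a b k r r' t :: real
      using that by (simp add: field_simps)
    show ?thesis
    proof
      assume "\<exists>a b. u = a * x + b * x' \<and> v = a * y + b * y' \<and> w = a * z + b * z'"
      then show "l * u + m * v + n * w = 0" by (auto simp: n algebra_simps)
    next
      assume e: "l * u + m * v + n * w = 0"
      consider "l \<noteq> 0" | "m \<noteq> 0" | "n \<noteq> 0" using ne by auto
      then show "\<exists>a b. u = a * x + b * x' \<and> v = a * y + b * y' \<and> w = a * z + b * z'"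
      proof cases
        case 1
        let ?a = "v * z' - w * y'" and ?b = "y * w - z * v"
        have "l * u = ?a * x + ?b * x' \<and> l * v = ?a * y + ?b * y' \<and> l * w = ?a * z + ?b * z'"
          using e unfolding n by (intro conjI; (algebra | simp add: algebra_simps))
        then show ?thesis using 1
          by - (rule exI[of _ "?a / l"], rule exI[of _ "?b / l"], intro conjI solve, simp_all)
      next
        case 2
        let ?a = "w * x' - u * z'" and ?b = "z * u - x * w"
        have "m * u = ?a * x + ?b * x' \<and> m * v = ?a * y + ?b * y' \<and> m * w = ?a * z + ?b * z'"
          using e unfolding n by (intro conjI; (algebra | simp add: algebra_simps))
        then show ?thesis using 2
          by - (rule exI[of _ "?a / m"], rule exI[of _ "?b / m"], intro conjI solve, simp_all)
      next
        case 3
        let ?a = "u * y' - v * x'" and ?b = "x * v - y * u"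
        have "n * u = ?a * x + ?b * x' \<and> n * v = ?a * y + ?b * y' \<and> n * w = ?a * z + ?b * z'"
          using e unfolding n by (intro conjI; (algebra | simp add: algebra_simps))
        then show ?thesis using 3
          by - (rule exI[of _ "?a / n"], rule exI[of _ "?b / n"], intro conjI solve, simp_all)
      qed
    qed
  qed
  finally show "bar u v w \<in> line_join (bar x y z) (bar x' y' z') \<longleftrightarrow> bar u v w \<in> bary_line l m n"
    using uvw by (simp add: in_bary_line_iff del: Pair_inject prod.inject)
qed

text \<open>The dual of the preceding fact. The coefficients \<open>k\<close> are passed separately, with equations, so
  that the result can be instantiated with simplified coordinates.\<close>

lemma bary_line_Int:
  assumes k: "k1 = m * n' - n * m'" "k2 = n * l' - l * n'" "k3 = l * m' - m * l'"
    and ne: "(k1, k2, k3) \<noteq> (0, 0, 0)"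
  shows "bary_line l m n \<inter> bary_line l' m' n' = {bar k1 k2 k3}"
proof (rule bary_set_eqI)
  fix x y z :: real assume xyz: "(x, y, z) \<noteq> (0, 0, 0)"
  have "l * x + m * y + n * z = 0 \<and> l' * x + m' * y + n' * z = 0 \<longleftrightarrow>
      y * k3 = z * k2 \<and> z * k1 = x * k3 \<and> x * k2 = y * k1"
  proof
    assume "l * x + m * y + n * z = 0 \<and> l' * x + m' * y + n' * z = 0"
    then show "y * k3 = z * k2 \<and> z * k1 = x * k3 \<and> x * k2 = y * k1"
      unfolding k by (intro conjI; algebra)
  next
    assume "y * k3 = z * k2 \<and> z * k1 = x * k3 \<and> x * k2 = y * k1"
    then obtain c where "x = c * k1" "y = c * k2" "z = c * k3"
      using parallel_iff_cross[OF ne] by blast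
    then show "l * x + m * y + n * z = 0 \<and> l' * x + m' * y + n' * z = 0"
      unfolding k by (intro conjI; algebra)
  qed
  then show "bar x y z \<in> bary_line l m n \<inter> bary_line l' m' n' \<longleftrightarrow> bar x y z \<in> {bar k1 k2 k3}"
    using bary_eq_iff[OF xyz ne] by (simp add: in_bary_line_iff[OF xyz])
qed

lemma line_meet_bary:
  assumes "k1 = m * n' - n * m'" "k2 = n * l' - l * n'" "k3 = l * m' - m * l'"
    and "(k1, k2, k3) \<noteq> (0, 0, 0)"
  shows "line_meet (bary_line l m n) (bary_line l' m' n') = bar k1 k2 k3"
  using bary_line_Int[OF assms] unfolding line_meet_def by (intro the_equality) auto

lemma l_inf_bary: "l_inf = bary_line 1 1 1"
proof (rule bary_set_eqI)
  fix x y z :: real assume xyz: "(x, y, z) \<noteq> (0, 0, 0)"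
  then have "comb x y z \<noteq> 0" by (auto simp: comb_zero_iff)
  then show "bar x y z \<in> l_inf \<longleftrightarrow> bar x y z \<in> bary_line 1 1 1"
    by (simp only: in_bary_line_iff[OF xyz]) (simp add: bary_def in_l_inf_iff)
qed

lemma pt_vertices: "pt A = bar 1 0 0" "pt B = bar 0 1 0" "pt C = bar 0 0 1"
  by (simp_all add: pt_def bary_def)

lemma bary_line_ne_l_inf:
  assumes "\<not> (l = m \<and> m = n)" shows "bary_line l m n \<noteq> l_inf"
proof
  assume "bary_line l m n = l_inf"
  moreover have "bar 1 (-1) 0 \<in> l_inf" "bar 0 1 (-1) \<in> l_inf" by (simp_all add: l_inf_bary in_bary_line_iff)
  ultimately have "bar 1 (-1) 0 \<in> bary_line l m n" "bar 0 1 (-1) \<in> bary_line l m n" by simp_all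
  then show False using assms by (simp add: in_bary_line_iff)
qed

text \<open>Parallelism means that the point at infinity of the second line, which is the cross product of its
  coefficients with \<open>(1, 1, 1)\<close>, lies on the first. The assumptions say that neither line is the
  line at infinity.\<close>

lemma parallel_lines_bary:
  assumes "\<not> (l = m \<and> m = n)" "\<not> (l' = m' \<and> m' = n')"
  shows "parallel_lines (bary_line l m n) (bary_line l' m' n') \<longleftrightarrow>
    l * (m' - n') + m * (n' - l') + n * (l' - m') = 0"
proof -
  have ne: "(m - n, n - l, l - m) \<noteq> (0, 0, 0)" and ne': "(m' - n', n' - l', l' - m') \<noteq> (0, 0, 0)"
    using assms by auto
  have "bary_line l m n \<inter> l_inf = {bar (m - n) (n - l) (l - m)}"
    unfolding l_inf_bary by (rule bary_line_Int) (use ne in auto)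
  moreover have "bary_line l' m' n' \<inter> l_inf = {bar (m' - n') (n' - l') (l' - m')}"
    unfolding l_inf_bary by (rule bary_line_Int) (use ne' in auto)
  moreover have "bar (m' - n') (n' - l') (l' - m') \<in> l_inf"
    using ne' by (simp add: l_inf_bary in_bary_line_iff)
  ultimately have "bary_line l m n \<inter> l_inf = bary_line l' m' n' \<inter> l_inf \<longleftrightarrow>
      bar (m' - n') (n' - l') (l' - m') \<in> bary_line l m n"
    by (metis Int_iff insertI1 singletonD)
  then show ?thesis using assms bary_line_ne_l_inf
    by (simp only: parallel_lines_def in_bary_line_iff[OF ne']) blast
qed

lemma bary_scale:
  assumes "c \<noteq> 0" shows "bar (c * x) (c * y) (c * z) = bar x y z"
proof (cases "(x, y, z) = (0, 0, 0)")
  case False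
  then show ?thesis using assms by (subst bary_eq_iff) (auto simp: mult.commute mult.left_commute)
qed simp

lemma pt_bary:
  assumes "x + y + z = 1" shows "pt (x *\<^sub>R A + y *\<^sub>R B + z *\<^sub>R C) = bar x y z"
proof -
  have "lift (x *\<^sub>R A + y *\<^sub>R B + z *\<^sub>R C) = comb x y z"
    using assms by (simp add: vec_eq_iff forall_3)
  then show ?thesis by (simp add: pt_def bary_def)
qed

lemma pt_midpoints:
  "pt (midpoint B C) = bar 0 1 1" "pt (midpoint C A) = bar 1 0 1" "pt (midpoint A B) = bar 1 1 0"
proof -
  show "pt (midpoint B C) = bar 0 1 1"
    using pt_bary[of 0 "1/2" "1/2"] bary_scale[of "1/2" 0 1 1] by (simp add: midpoint_def scaleR_right_distrib)
  show "pt (midpoint C A) = bar 1 0 1"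
    using pt_bary[of "1/2" 0 "1/2"] bary_scale[of "1/2" 1 0 1] by (simp add: midpoint_def scaleR_right_distrib add.commute)
  show "pt (midpoint A B) = bar 1 1 0"
    using pt_bary[of "1/2" "1/2" 0] bary_scale[of "1/2" 1 1 0] by (simp add: midpoint_def scaleR_right_distrib)
qed

lemma affine_bary:
  assumes "x + y + z \<noteq> 0"
  obtains x' y' z' where "x' + y' + z' = 1" "x = (x + y + z) * x'" "y = (x + y + z) * y'"
    "z = (x + y + z) * z'" "bar x y z = bar x' y' z'"
proof (rule that[of "x / (x + y + z)" "y / (x + y + z)" "z / (x + y + z)"])
  show "bar x y z = bar (x / (x + y + z)) (y / (x + y + z)) (z / (x + y + z))"
    using bary_scale[of "1 / (x + y + z)" x y z] assms by simp
qed (use assms in \<open>simp_all add: add_divide_distrib[symmetric]\<close>)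

section \<open>The maps defining the generalized orthocenter\<close>

lemma complement_bary:
  assumes xyz: "(x, y, z) \<noteq> (0, 0, 0)"
  shows "complement A B C (bar x y z) = bar (y + z) (z + x) (x + y)"
proof (cases "x + y + z = 0")
  case True
  then have "bar x y z \<in> l_inf" by (simp add: l_inf_bary in_bary_line_iff[OF xyz])
  moreover have e: "y + z = - 1 * x" "z + x = - 1 * y" "x + y = - 1 * z" using True by simp_all
  have "bar (y + z) (z + x) (x + y) = bar x y z" unfolding e by (rule bary_scale) simp
  ultimately show ?thesis by (simp add: complement_def)
next
  case False
  then obtain x' y' z' where n: "x' + y' + z' = 1" "x = (x + y + z) * x'" "y = (x + y + z) * y'"
    "z = (x + y + z) * z'" "bar x y z = bar x' y' z'" by (rule affine_bary)
  have halve: "2 * t * ((1 - r) / 2) = t - t * r" for r t :: real by (simp add: field_simps)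
  define p where "p = x' *\<^sub>R A + y' *\<^sub>R B + z' *\<^sub>R C"
  have p: "pt p = bar x y z" using pt_bary[OF n(1)] n(5) by (simp add: p_def)
  have "bar x y z \<notin> l_inf" using False by (simp add: l_inf_bary in_bary_line_iff[OF xyz])
  moreover have "(THE p. pt p = bar x y z) = p"
    using p by (intro the_equality) (simp_all add: pt_inj flip: p)
  ultimately have "complement A B C (bar x y z) =
      pt (centroid A B C + (- 1 / 2) *\<^sub>R (p - centroid A B C))"
    by (simp add: complement_def Let_def)
  also have "centroid A B C + (- 1 / 2) *\<^sub>R (p - centroid A B C) =
      ((1 - x') / 2) *\<^sub>R A + ((1 - y') / 2) *\<^sub>R B + ((1 - z') / 2) *\<^sub>R C"
    by (simp add: vec_eq_iff p_def centroid_def field_simps)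
  also have "pt \<dots> = bar ((1 - x') / 2) ((1 - y') / 2) ((1 - z') / 2)"
    by (rule pt_bary) (use n(1) in \<open>simp add: field_simps\<close>)
  also have "\<dots> = bar (2 * (x + y + z) * ((1 - x') / 2)) (2 * (x + y + z) * ((1 - y') / 2))
      (2 * (x + y + z) * ((1 - z') / 2))"
    using False by (subst bary_scale) auto
  also have "2 * (x + y + z) * ((1 - x') / 2) = y + z" unfolding halve using n(2) by linarith
  also have "2 * (x + y + z) * ((1 - y') / 2) = z + x" unfolding halve using n(3) by linarith
  also have "2 * (x + y + z) * ((1 - z') / 2) = x + y" unfolding halve using n(4) by linarith
  finally show ?thesis .
qed

lemma isotomic_bary:
  assumes "x \<noteq> 0" "y \<noteq> 0" "z \<noteq> 0"
  shows "isotomic A B C (bar x y z) = bar (y * z) (z * x) (x * y)"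
  unfolding isotomic_def
proof (rule the_equality)
  have "bar (y * z) (z * x) (x * y) = bar (1 / x) (1 / y) (1 / z)"
    using assms by (subst bary_eq_iff) (simp_all add: field_simps)
  then show "\<exists>x' y' z'. x' \<noteq> 0 \<and> y' \<noteq> 0 \<and> z' \<noteq> 0 \<and> bar x y z = bar x' y' z' \<and>
      bar (y * z) (z * x) (x * y) = bar (1 / x') (1 / y') (1 / z')"
    using assms by blast
next
  fix Y assume "\<exists>x' y' z'. x' \<noteq> 0 \<and> y' \<noteq> 0 \<and> z' \<noteq> 0 \<and> bar x y z = bar x' y' z' \<and>
      Y = bar (1 / x') (1 / y') (1 / z')"
  then obtain x' y' z' where e: "x' \<noteq> 0" "y' \<noteq> 0" "z' \<noteq> 0" "bar x y z = bar x' y' z'"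
      "Y = bar (1 / x') (1 / y') (1 / z')" by blast
  then have "y * z' = z * y'" "z * x' = x * z'" "x * y' = y * x'"
    using assms by (simp_all add: bary_eq_iff)
  then show "Y = bar (y * z) (z * x) (x * y)"
    unfolding e(5) using assms e(1-3) by (subst bary_eq_iff) (simp_all add: field_simps)
qed

lemma sides_bary:
  "line_join (pt B) (pt C) = bary_line 1 0 0"
  "line_join (pt C) (pt A) = bary_line 0 1 0"
  "line_join (pt A) (pt B) = bary_line 0 0 1"
  unfolding pt_vertices by (rule line_join_bary; simp)+

lemma has_gen_orthocenter_bary:
  assumes xyz: "(x, y, z) \<noteq> (0, 0, 0)"
  shows "has_gen_orthocenter A B C (bar x y z) \<longleftrightarrow>
    x \<noteq> 0 \<and> y \<noteq> 0 \<and> z \<noteq> 0 \<and> y + z \<noteq> 0 \<and> z + x \<noteq> 0 \<and> x + y \<noteq> 0"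
proof -
  have "(y + z, z + x, x + y) \<noteq> (0, 0, 0)" using xyz by auto
  then show ?thesis
    using xyz by (auto simp: has_gen_orthocenter_def side_lines_def sides_bary anticomplement_def
        complement_bary in_bary_line_iff)
qed

section \<open>The generalized orthocenter\<close>

text \<open>The point \<open>H = A\<close>, for which the parallelism is void, also satisfies the equation on the right, so
  one linear equation covers both alternatives. The equation expresses that the point at infinity of
  \<open>QD\<close> lies on \<open>HA\<close>.\<close>

lemma parallel_to_vertex_iff:
  fixes x y z u v w s :: real
  assumes nz: "x \<noteq> 0" "y \<noteq> 0" "z \<noteq> 0" "y + z \<noteq> 0" and uvw: "(u, v, w) \<noteq> (0, 0, 0)"
    and s: "s = x * y + y * z + z * x"
  shows "bar u v w = pt A \<or> parallel_lines (line_join (bar u v w) (pt A))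
      (line_join (bar (x * (y + z)) (y * (z + x)) (z * (x + y)))
        (line_meet (line_join (pt A) (bar x y z)) (line_join (pt B) (pt C)))) \<longleftrightarrow>
    v * (z * (y\<^sup>2 - s)) = w * (y * (z\<^sup>2 - s))"
proof -
  have A: "bar u v w = pt A \<longleftrightarrow> v = 0 \<and> w = 0"
    unfolding pt_vertices using uvw by (subst bary_eq_iff) auto
  show ?thesis
  proof (cases "v = 0 \<and> w = 0")
    case False
    have "line_join (pt A) (bar x y z) = bary_line 0 (- z) y"
      unfolding pt_vertices by (rule line_join_bary) (use nz in auto)
    then have "line_meet (line_join (pt A) (bar x y z)) (line_join (pt B) (pt C)) = bar 0 y z"
      unfolding sides_bary by (simp only:) (rule line_meet_bary, use nz in auto)
    moreover have "line_join (bar (x * (y + z)) (y * (z + x)) (z * (x + y))) (bar 0 y z) =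
        bary_line (y * z * (z - y)) (- (x * z * (y + z))) (x * y * (y + z))"
    proof (rule line_join_bary)
      show "y * z * (z - y) = y * (z + x) * z - z * (x + y) * y" by (simp add: algebra_simps)
    qed (use nz in \<open>simp_all add: ac_simps\<close>)
    moreover have "line_join (bar u v w) (pt A) = bary_line 0 w (- v)"
      unfolding pt_vertices by (rule line_join_bary) (use False in auto)
    moreover have "parallel_lines (bary_line 0 w (- v))
        (bary_line (y * z * (z - y)) (- (x * z * (y + z))) (x * y * (y + z))) \<longleftrightarrow>
      0 * (- (x * z * (y + z)) - x * y * (y + z)) + w * (x * y * (y + z) - y * z * (z - y))
        + - v * (y * z * (z - y) - - (x * z * (y + z))) = 0"
    proof (rule parallel_lines_bary)
      have "x * y * (y + z) - - (x * z * (y + z)) = x * (y + z) * (y + z)" by (simp add: algebra_simps)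
      moreover have "x * (y + z) * (y + z) \<noteq> 0" using nz by simp
      ultimately show "\<not> (y * z * (z - y) = - (x * z * (y + z)) \<and> - (x * z * (y + z)) = x * y * (y + z))"
        by linarith
    qed (use False in auto)
    moreover have "0 * (- (x * z * (y + z)) - x * y * (y + z)) + w * (x * y * (y + z) - y * z * (z - y))
        + - v * (y * z * (z - y) - - (x * z * (y + z))) =
        v * (z * (y\<^sup>2 - s)) - w * (y * (z\<^sup>2 - s))"
      unfolding s by algebra
    ultimately show ?thesis by (simp only: A False simp_thms right_minus_eq)
  next
    case True
    then have "bar u v w = pt A" using A by blast
    with True show ?thesis by simp
  qed
qed

lemma triangle_cycle: "triangle B C A"
  using noncollinear by (simp add: triangle_def insert_commute)

text \<open>Each component of the cross product of \<open>H\<close> with \<open>(x b c, y c a, z a b)\<close> is a multiple of one of the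
  three linear equations, so every solution \<open>H\<close> is proportional to this vector. The vector is nonzero because at most one of \<open>a\<close>, \<open>b\<close>, \<open>c\<close> vanishes: if, say,
  \<open>a = b = 0\<close>, then \<open>x\<^sup>2 = y\<^sup>2\<close>, so \<open>x = y\<close> as \<open>x + y\<close> is nonzero, and then \<open>x\<^sup>2 = s\<close> gives \<open>x z = 0\<close>.\<close>

lemma gen_orthocenter_bary:
  fixes x y z s :: real
  assumes has: "has_gen_orthocenter A B C (bar x y z)" and xyz: "(x, y, z) \<noteq> (0, 0, 0)"
    and s: "s = x * y + y * z + z * x"
  defines "a \<equiv> x\<^sup>2 - s" and "b \<equiv> y\<^sup>2 - s" and "c \<equiv> z\<^sup>2 - s"
  shows "gen_orthocenter A B C (bar x y z) = bar (x * b * c) (y * c * a) (z * a * b)"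
    and "gen_orthocenter A B C (bar x y z) = pt A \<longleftrightarrow> a = 0"
proof -
  interpret BCA: triangle B C A by (rule triangle_cycle)
  interpret CAB: triangle C A B by (rule BCA.triangle_cycle)
  have nz: "x \<noteq> 0" "y \<noteq> 0" "z \<noteq> 0" "y + z \<noteq> 0" "z + x \<noteq> 0" "x + y \<noteq> 0"
    using has by (simp_all add: has_gen_orthocenter_bary[OF xyz])
  have sq: False if "p\<^sup>2 = q\<^sup>2" "p\<^sup>2 = p * q + q * r + r * p" "p \<noteq> 0" "r \<noteq> 0" "p + q \<noteq> 0" for p q r :: real
  proof -
    have "p = q" using that(1,5) by (auto simp: power2_eq_iff)
    then show False using that(2-4) by (simp add: power2_eq_square)
  qed
  have ab: "\<not> (a = 0 \<and> b = 0)" using sq[of x y z] nz by (auto simp: a_def b_def s)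
  have bc: "\<not> (b = 0 \<and> c = 0)" using sq[of y z x] nz by (auto simp: b_def c_def s)
  have ca: "\<not> (c = 0 \<and> a = 0)" using sq[of z x y] nz by (auto simp: c_def a_def s)
  have ne: "(x * b * c, y * c * a, z * a * b) \<noteq> (0, 0, 0)"
    using nz ab bc ca by auto
  have Q: "complement A B C (isotomic A B C (bar x y z)) = bar (x * (y + z)) (y * (z + x)) (z * (x + y))"
    using nz by (simp add: isotomic_bary complement_bary algebra_simps)
  define D where "D = line_meet (line_join (pt A) (bar x y z)) (line_join (pt B) (pt C))"
  define E where "E = line_meet (line_join (pt B) (bar x y z)) (line_join (pt C) (pt A))"
  define F where "F = line_meet (line_join (pt C) (bar x y z)) (line_join (pt A) (pt B))"
  define Q where "Q = bar (x * (y + z)) (y * (z + x)) (z * (x + y))"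
  define \<Phi> where "\<Phi> H \<longleftrightarrow>
      (H = pt A \<or> parallel_lines (line_join H (pt A)) (line_join Q D)) \<and>
      (H = pt B \<or> parallel_lines (line_join H (pt B)) (line_join Q E)) \<and>
      (H = pt C \<or> parallel_lines (line_join H (pt C)) (line_join Q F))" for H
  have \<Phi>_bary: "\<Phi> (bar u v w) \<longleftrightarrow> v * (z * b) = w * (y * c) \<and> w * (x * c) = u * (z * a) \<and> u * (y * a) = v * (x * b)"
    if uvw: "(u, v, w) \<noteq> (0, 0, 0)" for u v w
  proof -
    have "bar u v w = pt A \<or> parallel_lines (line_join (bar u v w) (pt A)) (line_join Q D)
        \<longleftrightarrow> v * (z * b) = w * (y * c)"
      unfolding Q_def D_def b_def c_def
      by (rule parallel_to_vertex_iff) (use nz uvw s in auto)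
    moreover have "bar u v w = pt B \<or> parallel_lines (line_join (bar u v w) (pt B)) (line_join Q E)
        \<longleftrightarrow> w * (x * c) = u * (z * a)"
      unfolding Q_def E_def c_def a_def bary_cycle[of A B C]
      by (rule BCA.parallel_to_vertex_iff) (use nz uvw s in auto)
    moreover have "bar u v w = pt C \<or> parallel_lines (line_join (bar u v w) (pt C)) (line_join Q F)
        \<longleftrightarrow> u * (y * a) = v * (x * b)"
      unfolding Q_def F_def a_def b_def bary_cycle[of C A B, symmetric]
      by (rule CAB.parallel_to_vertex_iff) (use nz uvw s in auto)
    ultimately show ?thesis unfolding \<Phi>_def by blast
  qed
  have "gen_orthocenter A B C (bar x y z) = (THE H. \<Phi> H)"
    unfolding gen_orthocenter_def Let_def Q \<Phi>_def D_def E_def F_def Q_def ..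
  also have "\<dots> = bar (x * b * c) (y * c * a) (z * a * b)"
  proof (rule the_equality)
    show "\<Phi> (bar (x * b * c) (y * c * a) (z * a * b))"
      unfolding \<Phi>_bary[OF ne] by (simp add: algebra_simps)
  next
    fix H assume H: "\<Phi> H"
    obtain u v w where uvw: "(u, v, w) \<noteq> (0, 0, 0)" "H = bar u v w" by (rule bary_exists)
    then have "v * (z * b) = w * (y * c)" "w * (x * c) = u * (z * a)" "u * (y * a) = v * (x * b)"
      using H \<Phi>_bary by auto
    then show "H = bar (x * b * c) (y * c * a) (z * a * b)"
      unfolding uvw(2) bary_eq_iff[OF uvw(1) ne] by (intro conjI; algebra)
  qed
  finally show G: "gen_orthocenter A B C (bar x y z) = bar (x * b * c) (y * c * a) (z * a * b)" .
  have "bar (x * b * c) (y * c * a) (z * a * b) = pt A \<longleftrightarrow> y * c * a = 0 \<and> z * a * b = 0"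
    unfolding pt_vertices using ne by (subst bary_eq_iff) auto
  then show "gen_orthocenter A B C (bar x y z) = pt A \<longleftrightarrow> a = 0"
    unfolding G using nz bc by auto
qed

text \<open>Relabelling the vertices cyclically permutes the coordinates cyclically, and the coordinate
  expressions for admissibility, for \<open>H\<close> and for the Steiner circumellipse are invariant under this.
  So results about the vertex \<open>A\<close> carry over to \<open>B\<close> and \<open>C\<close>.\<close>

lemma has_gen_orthocenter_cycle:
  "has_gen_orthocenter B C A P \<longleftrightarrow> has_gen_orthocenter A B C P"
proof -
  interpret BCA: triangle B C A by (rule triangle_cycle)
  obtain x y z where xyz: "(x, y, z) \<noteq> (0, 0, 0)" "P = bar x y z" by (rule bary_exists)
  then have "(y, z, x) \<noteq> (0, 0, 0)" by auto
  then have "has_gen_orthocenter B C A (bary B C A y z x) \<longleftrightarrow> has_gen_orthocenter A B C (bar x y z)"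
    unfolding has_gen_orthocenter_bary[OF xyz(1)] by (subst BCA.has_gen_orthocenter_bary) auto
  then show ?thesis by (simp add: xyz(2) bary_cycle[of A B C, symmetric])
qed

lemma gen_orthocenter_cycle:
  assumes "has_gen_orthocenter A B C P"
  shows "gen_orthocenter B C A P = gen_orthocenter A B C P"
proof -
  interpret BCA: triangle B C A by (rule triangle_cycle)
  obtain x y z where xyz: "(x, y, z) \<noteq> (0, 0, 0)" "P = bar x y z" by (rule bary_exists)
  define s where "s = x * y + y * z + z * x"
  have P: "P = bary B C A y z x" using xyz(2) bary_cycle by simp
  have "gen_orthocenter B C A P = bary B C A (y * (z\<^sup>2 - s) * (x\<^sup>2 - s)) (z * (x\<^sup>2 - s) * (y\<^sup>2 - s))
      (x * (y\<^sup>2 - s) * (z\<^sup>2 - s))"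
    unfolding P by (rule BCA.gen_orthocenter_bary)
      (use xyz assms in \<open>auto simp: s_def has_gen_orthocenter_cycle bary_cycle[of A B C, symmetric]\<close>)
  also have "\<dots> = bar (x * (y\<^sup>2 - s) * (z\<^sup>2 - s)) (y * (z\<^sup>2 - s) * (x\<^sup>2 - s)) (z * (x\<^sup>2 - s) * (y\<^sup>2 - s))"
    by (rule bary_cycle[symmetric])
  also have "\<dots> = gen_orthocenter A B C P"
    unfolding xyz(2) by (rule gen_orthocenter_bary(1)[symmetric])
      (use xyz assms in \<open>auto simp: s_def\<close>)
  finally show ?thesis .
qed

lemma steiner_cycle: "steiner_circumellipse B C A = steiner_circumellipse A B C"
proof (rule bary_set_eqI)
  interpret BCA: triangle B C A by (rule triangle_cycle)
  fix x y z :: real assume xyz: "(x, y, z) \<noteq> (0, 0, 0)"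
  then have "(y, z, x) \<noteq> (0, 0, 0)" by auto
  then have "bary B C A y z x \<in> steiner_circumellipse B C A \<longleftrightarrow> y * z + z * x + x * y = 0"
    by (rule BCA.in_steiner_iff)
  then show "bar x y z \<in> steiner_circumellipse B C A \<longleftrightarrow> bar x y z \<in> steiner_circumellipse A B C"
    unfolding in_steiner_iff[OF xyz] unfolding bary_cycle[of A B C] by (simp add: ac_simps)
qed

section \<open>The locus belonging to one vertex\<close>

definition apex_conic :: "ext_point set" where
  "apex_conic = {bar x y z | x y z. (x, y, z) \<noteq> (0, 0, 0) \<and> x\<^sup>2 = x * y + y * z + z * x}"

lemma in_apex_conic_iff:
  assumes "(x, y, z) \<noteq> (0, 0, 0)"
  shows "bar x y z \<in> apex_conic \<longleftrightarrow> x\<^sup>2 = x * y + y * z + z * x"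
  unfolding apex_conic_def
proof (rule in_bary_set_iff[OF assms])
  fix x y z c :: real assume "x\<^sup>2 = x * y + y * z + z * x"
  then have "c\<^sup>2 * x\<^sup>2 = c\<^sup>2 * (x * y + y * z + z * x)" by simp
  then show "(c * x)\<^sup>2 = c * x * (c * y) + c * y * (c * z) + c * z * (c * x)"
    by (simp add: algebra_simps power2_eq_square)
qed

text \<open>On the conic \<open>x\<^sup>2 = s\<close>, a vanishing coordinate leaves only \<open>B\<close>, \<open>C\<close> and the midpoints of \<open>CA\<close> and
  \<open>AB\<close>. A vanishing sum of two coordinates turns the equation into a vanishing sum of squares, which
  forces \<open>x = 0\<close>.\<close>

lemma vertex_locus:
  "{P. has_gen_orthocenter A B C P \<and> gen_orthocenter A B C P = pt A} =
    apex_conic - {pt A, pt B, pt C, pt (midpoint B C), pt (midpoint C A), pt (midpoint A B)}"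
proof (rule bary_set_eqI)
  fix x y z :: real assume xyz: "(x, y, z) \<noteq> (0, 0, 0)"
  let ?E = "x\<^sup>2 = x * y + y * z + z * x"
  let ?N = "x \<noteq> 0 \<and> y \<noteq> 0 \<and> z \<noteq> 0 \<and> y + z \<noteq> 0 \<and> z + x \<noteq> 0 \<and> x + y \<noteq> 0"
  let ?D = "y = 0 \<and> z = 0 \<or> z = 0 \<and> x = 0 \<or> x = 0 \<and> y = 0 \<or>
      x = 0 \<and> y = z \<or> y = 0 \<and> z = x \<or> z = 0 \<and> x = y"
  have locus: "bar x y z \<in> {P. has_gen_orthocenter A B C P \<and> gen_orthocenter A B C P = pt A} \<longleftrightarrow> ?N \<and> ?E"
    using has_gen_orthocenter_bary[OF xyz] gen_orthocenter_bary(2)[OF _ xyz refl] by auto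
  have excluded: "bar x y z \<in> {pt A, pt B, pt C, pt (midpoint B C), pt (midpoint C A), pt (midpoint A B)} \<longleftrightarrow> ?D"
    unfolding pt_vertices pt_midpoints using xyz by (auto simp: bary_eq_iff)
  have "?N \<and> ?E \<longleftrightarrow> ?E \<and> \<not> ?D"
  proof (cases ?E)
    case e: True
    have "y = 0 \<or> z = 0" if "x = 0" using e that by simp
    moreover have "x = 0 \<or> z = x" if "y = 0" using e that by (auto simp: power2_eq_square)
    moreover have "x = 0 \<or> x = y" if "z = 0" using e that by (auto simp: power2_eq_square)
    moreover have "x = 0" if "y + z = 0"
    proof -
      have "x\<^sup>2 + y\<^sup>2 = 0" using e that by algebra
      then show ?thesis by simp
    qed
    moreover have "x = 0" if "z + x = 0"
    proof -
      have "x\<^sup>2 = 0" using e that by algebra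
      then show ?thesis by simp
    qed
    moreover have "x = 0" if "x + y = 0"
    proof -
      have "x\<^sup>2 = 0" using e that by algebra
      then show ?thesis by simp
    qed
    ultimately have "?N \<longleftrightarrow> \<not> ?D" by blast
    with e show ?thesis by blast
  qed blast
  then show "bar x y z \<in> {P. has_gen_orthocenter A B C P \<and> gen_orthocenter A B C P = pt A} \<longleftrightarrow>
      bar x y z \<in> apex_conic - {pt A, pt B, pt C, pt (midpoint B C), pt (midpoint C A), pt (midpoint A B)}"
    unfolding Diff_iff locus excluded in_apex_conic_iff[OF xyz] .
qed

section \<open>The conics as polarities\<close>

text \<open>A quadratic form given in barycentric coordinates has the matrix \<open>T\<^sup>t N T\<close> in the standard
  coordinates, where \<open>T\<close> inverts the change of coordinates.\<close>

lemma bary_form_exists: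
  assumes "polarity N"
  obtains M where "polarity M"
    and "\<And>x y z x' y' z'. comb x y z \<bullet> (M *v comb x' y' z') = vector [x, y, z] \<bullet> (N *v vector [x', y', z'])"
proof -
  obtain T where T: "T ** frame A B C = mat 1" "frame A B C ** T = mat 1" by (rule frame_inverse)
  define M where "M = transpose T ** N ** T"
  have T_comb: "T *v comb x y z = vector [x, y, z]" for x y z
  proof -
    have "comb x y z = frame A B C *v vector [x, y, z]" by (simp add: frame_mult vector_3)
    then show ?thesis by (simp add: matrix_vector_mul_assoc T)
  qed
  have "det T * det (frame A B C) = 1" using T(1) by (metis det_I det_mul)
  then have "det T \<noteq> 0" by auto
  then have "polarity M"
    using assms by (simp add: polarity_def M_def matrix_transpose_mul matrix_mul_assoc det_mul det_transpose)
  moreover have "comb x y z \<bullet> (M *v comb x' y' z') = vector [x, y, z] \<bullet> (N *v vector [x', y', z'])"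
    for x y z x' y' z'
  proof -
    have "M *v comb x' y' z' = transpose T *v (N *v vector [x', y', z'])"
      by (simp add: M_def T_comb flip: matrix_vector_mul_assoc)
    then have "comb x y z \<bullet> (M *v comb x' y' z') = ((N *v vector [x', y', z']) v* T) \<bullet> comb x y z"
      by (simp only: transpose_matrix_vector) (rule inner_commute)
    also have "\<dots> = (N *v vector [x', y', z']) \<bullet> vector [x, y, z]"
      by (simp only: dot_lmul_matrix T_comb)
    finally show ?thesis by (simp only: inner_commute)
  qed
  ultimately show ?thesis by (rule that)
qed

lemma in_polar_bary:
  assumes "(x, y, z) \<noteq> (0, 0, 0)" "(x', y', z') \<noteq> (0, 0, 0)"
  shows "bar x' y' z' \<in> polar M (bar x y z) \<longleftrightarrow> comb x y z \<bullet> (M *v comb x' y' z') = 0"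
  unfolding bary_def by (rule in_polar_iff) (use assms in \<open>auto simp: comb_zero_iff\<close>)

lemma polar_bary_line:
  assumes xyz: "(x, y, z) \<noteq> (0, 0, 0)"
    and form: "\<And>u v w. comb x y z \<bullet> (M *v comb u v w) = 0 \<longleftrightarrow> l * u + m * v + n * w = 0"
  shows "polar M (bar x y z) = bary_line l m n"
proof (rule bary_set_eqI)
  fix u v w :: real assume uvw: "(u, v, w) \<noteq> (0, 0, 0)"
  show "bar u v w \<in> polar M (bar x y z) \<longleftrightarrow> bar u v w \<in> bary_line l m n"
    by (simp only: in_polar_bary[OF xyz uvw] in_bary_line_iff[OF uvw] form)
qed

lemma apex_conic_polarity:
  obtains M where "polarity M" "apex_conic = self_conjugate M"
    "polar M (pt B) = bary_line 1 0 1" "polar M (pt C) = bary_line 1 1 0"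
proof -
  let ?N = "vector [vector [2, -1, -1], vector [-1, 0, -1], vector [-1, -1, 0]] :: real^3^3"
  have "polarity ?N"
    by (simp add: polarity_def vec_eq_iff forall_3 transpose_def vector_3 det_3)
  then obtain M where M: "polarity M" "\<And>x y z x' y' z'. comb x y z \<bullet> (M *v comb x' y' z') =
      vector [x, y, z] \<bullet> (?N *v vector [x', y', z'])" by (rule bary_form_exists) blast
  have form: "comb x y z \<bullet> (M *v comb x' y' z') =
      2 * x * x' - x * y' - x' * y - y * z' - y' * z - z * x' - z' * x" for x y z x' y' z'
    unfolding M(2) by (simp add: inner_vec_def sum_3 matrix_vector_mult_def vector_3 algebra_simps)
  show ?thesis
  proof (rule that[OF M(1)])
    show "apex_conic = self_conjugate M"
    proof (rule bary_set_eqI)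
      fix x y z :: real assume xyz: "(x, y, z) \<noteq> (0, 0, 0)"
      show "bar x y z \<in> apex_conic \<longleftrightarrow> bar x y z \<in> self_conjugate M"
        unfolding self_conjugate_def mem_Collect_eq in_polar_bary[OF xyz xyz] in_apex_conic_iff[OF xyz] form
        by (auto simp: power2_eq_square algebra_simps)
    qed
    show "polar M (pt B) = bary_line 1 0 1" "polar M (pt C) = bary_line 1 1 0"
      unfolding pt_vertices by (rule polar_bary_line, simp, unfold form, (auto)[1])+
  qed
qed

lemma steiner_polarity:
  obtains M where "polarity M" "steiner_circumellipse A B C = self_conjugate M"
    "polar M (pt B) = bary_line 1 0 1" "polar M (pt C) = bary_line 1 1 0"
proof -
  let ?N = "vector [vector [0, 1, 1], vector [1, 0, 1], vector [1, 1, 0]] :: real^3^3"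
  have "polarity ?N"
    by (simp add: polarity_def vec_eq_iff forall_3 transpose_def vector_3 det_3)
  then obtain M where M: "polarity M" "\<And>x y z x' y' z'. comb x y z \<bullet> (M *v comb x' y' z') =
      vector [x, y, z] \<bullet> (?N *v vector [x', y', z'])" by (rule bary_form_exists) blast
  have form: "comb x y z \<bullet> (M *v comb x' y' z') =
      x * y' + x' * y + y * z' + y' * z + z * x' + z' * x" for x y z x' y' z'
    unfolding M(2) by (simp add: inner_vec_def sum_3 matrix_vector_mult_def vector_3 algebra_simps)
  show ?thesis
  proof (rule that[OF M(1)])
    show "steiner_circumellipse A B C = self_conjugate M"
    proof (rule bary_set_eqI)
      fix x y z :: real assume xyz: "(x, y, z) \<noteq> (0, 0, 0)"
      show "bar x y z \<in> steiner_circumellipse A B C \<longleftrightarrow> bar x y z \<in> self_conjugate M"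
        unfolding self_conjugate_def mem_Collect_eq in_polar_bary[OF xyz xyz] in_steiner_iff[OF xyz] form
        by (auto simp: algebra_simps)
    qed
    show "polar M (pt B) = bary_line 1 0 1" "polar M (pt C) = bary_line 1 1 0"
      unfolding pt_vertices by (rule polar_bary_line, simp, unfold form, (auto)[1])+
  qed
qed

lemma anticomplement_sides:
  "anticomplement A B C (line_join (pt A) (pt C)) = bary_line 1 0 1"
  "anticomplement A B C (line_join (pt A) (pt B)) = bary_line 1 1 0"
proof -
  have K: "(y + z, z + x, x + y) \<noteq> (0, 0, 0)" if "(x, y, z) \<noteq> (0, 0, 0)" for x y z :: real
    using that by auto
  have AC: "line_join (pt A) (pt C) = bary_line 0 1 0"
    using sides_bary(2) line_join_commute by metis
  show "anticomplement A B C (line_join (pt A) (pt C)) = bary_line 1 0 1"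
  proof (rule bary_set_eqI)
    fix x y z :: real assume xyz: "(x, y, z) \<noteq> (0, 0, 0)"
    show "bar x y z \<in> anticomplement A B C (line_join (pt A) (pt C)) \<longleftrightarrow> bar x y z \<in> bary_line 1 0 1"
      unfolding AC anticomplement_def vimage_eq complement_bary[OF xyz] in_bary_line_iff[OF K[OF xyz]]
        in_bary_line_iff[OF xyz] by (simp add: add.commute)
  qed
  show "anticomplement A B C (line_join (pt A) (pt B)) = bary_line 1 1 0"
  proof (rule bary_set_eqI)
    fix x y z :: real assume xyz: "(x, y, z) \<noteq> (0, 0, 0)"
    show "bar x y z \<in> anticomplement A B C (line_join (pt A) (pt B)) \<longleftrightarrow> bar x y z \<in> bary_line 1 1 0"
      unfolding sides_bary anticomplement_def vimage_eq complement_bary[OF xyz]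
        in_bary_line_iff[OF K[OF xyz]] in_bary_line_iff[OF xyz] by simp
  qed
qed

text \<open>Let \<open>q\<close> be the form of a polarity that provides the tangent at \<open>B\<close>. Incidence with \<open>B\<close> and \<open>C\<close> kills
  \<open>q B B\<close> and \<open>q C C\<close>, the tangent at \<open>B\<close> gives \<open>q A B = q B C\<close>, and the two midpoints give
  \<open>q A A = - 2 q A B = - 2 q C A\<close>. So \<open>q\<close> is a multiple of the form of \<open>x\<^sup>2 - s\<close>; the multiple is not
  zero, as otherwise the polar of \<open>B\<close> would be the whole plane.\<close>

lemma is_vertex_conic_iff: "is_vertex_conic A B C S \<longleftrightarrow> S = apex_conic"
proof
  obtain M where M: "polarity M" "apex_conic = self_conjugate M"
    "polar M (pt B) = bary_line 1 0 1" "polar M (pt C) = bary_line 1 1 0"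
    by (rule apex_conic_polarity)
  have on: "{pt B, pt C, pt (midpoint C A), pt (midpoint A B)} \<subseteq> apex_conic"
    unfolding pt_vertices pt_midpoints by (simp add: in_apex_conic_iff)
  assume "S = apex_conic"
  then show "is_vertex_conic A B C S"
    unfolding is_vertex_conic_def is_conic_def tangent_line_def anticomplement_sides
    using M on by blast
next
  assume S: "is_vertex_conic A B C S"
  then obtain M where M: "polarity M" "S = self_conjugate M" "bary_line 1 0 1 = polar M (pt B)"
    unfolding is_vertex_conic_def tangent_line_def anticomplement_sides by blast
  define q where "q u v = u \<bullet> (M *v v)" for u v
  have q_commute: "q u v = q v u" for u v
  proof -
    have "q u v = (u v* M) \<bullet> v" by (simp add: q_def dot_lmul_matrix)
    also have "u v* M = M *v u"
      using M(1) by (metis polarity_def transpose_matrix_vector)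
    finally show ?thesis by (simp add: q_def inner_commute)
  qed
  let ?a = "lift A" and ?b = "lift B" and ?c = "lift C"
  have q_comb: "q (comb x y z) (comb x' y' z') = x * x' * q ?a ?a + y * y' * q ?b ?b + z * z' * q ?c ?c
      + (x * y' + y * x') * q ?a ?b + (y * z' + z * y') * q ?b ?c + (z * x' + x * z') * q ?c ?a" for x y z x' y' z'
    using q_commute[of ?b ?a] q_commute[of ?c ?b] q_commute[of ?a ?c]
    by (simp add: q_def inner_add_left inner_add_right matrix_vector_right_distrib matrix_vector_mult_scaleR algebra_simps)
  have conj: "bar x y z \<in> S \<longleftrightarrow> q (comb x y z) (comb x y z) = 0" if "(x, y, z) \<noteq> (0, 0, 0)" for x y z
    unfolding M(2) self_conjugate_def mem_Collect_eq in_polar_bary[OF that that] q_def ..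
  have tang: "bar x y z \<in> bary_line 1 0 1 \<longleftrightarrow> q (comb 0 1 0) (comb x y z) = 0" if "(x, y, z) \<noteq> (0, 0, 0)" for x y z
    unfolding M(3) pt_vertices q_def by (rule in_polar_bary) (use that in auto)
  have on: "bar 0 1 0 \<in> S" "bar 0 0 1 \<in> S" "bar 1 0 1 \<in> S" "bar 1 1 0 \<in> S"
    using S unfolding is_vertex_conic_def pt_vertices pt_midpoints by auto
  have "q ?b ?b = 0" using on(1) by (subst (asm) conj) (simp, unfold q_comb, simp)
  moreover have "q ?c ?c = 0" using on(2) by (subst (asm) conj) (simp, unfold q_comb, simp)
  moreover have "q ?a ?a + q ?c ?c + 2 * q ?c ?a = 0" using on(3) by (subst (asm) conj) (simp, unfold q_comb, simp)
  moreover have "q ?a ?a + q ?b ?b + 2 * q ?a ?b = 0" using on(4) by (subst (asm) conj) (simp, unfold q_comb, simp)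
  \<comment> \<open>The point at infinity of \<open>CA\<close> lies on the tangent at \<open>B\<close>.\<close>
  moreover have "q ?a ?b = q ?b ?c"
    using tang[of 1 0 "-1"] unfolding q_comb by (simp add: in_bary_line_iff)
  ultimately have q: "q ?b ?b = 0" "q ?c ?c = 0" "q ?a ?a = - 2 * q ?a ?b" "q ?c ?a = q ?a ?b" "q ?b ?c = q ?a ?b"
    by simp_all
  \<comment> \<open>The vertex \<open>A\<close> does not lie on the tangent at \<open>B\<close>.\<close>
  have "q ?a ?b \<noteq> 0"
    using tang[of 1 0 0] unfolding q_comb by (simp add: in_bary_line_iff)
  moreover have "q (comb x y z) (comb x y z) = - 2 * q ?a ?b * (x\<^sup>2 - (x * y + y * z + z * x))" for x y z
    unfolding q_comb q by (simp add: algebra_simps power2_eq_square)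
  ultimately show "S = apex_conic"
    by (intro bary_set_eqI) (simp add: conj in_apex_conic_iff del: prod.inject)
qed

lemma vertex_conic_eq: "vertex_conic A B C = apex_conic"
  by (simp add: vertex_conic_def is_vertex_conic_iff)

lemma apex_conic_tangent_steiner:
  "conics_tangent_at apex_conic (steiner_circumellipse A B C) (pt B)"
  "conics_tangent_at apex_conic (steiner_circumellipse A B C) (pt C)"
proof -
  obtain M where M: "polarity M" "apex_conic = self_conjugate M"
    "polar M (pt B) = bary_line 1 0 1" "polar M (pt C) = bary_line 1 1 0"
    by (rule apex_conic_polarity)
  obtain N where N: "polarity N" "steiner_circumellipse A B C = self_conjugate N"
    "polar N (pt B) = bary_line 1 0 1" "polar N (pt C) = bary_line 1 1 0"
    by (rule steiner_polarity)
  have "pt B \<in> apex_conic" "pt C \<in> apex_conic"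
    "pt B \<in> steiner_circumellipse A B C" "pt C \<in> steiner_circumellipse A B C"
    unfolding pt_vertices by (simp_all add: in_apex_conic_iff in_steiner_iff)
  then show "conics_tangent_at apex_conic (steiner_circumellipse A B C) (pt B)"
    "conics_tangent_at apex_conic (steiner_circumellipse A B C) (pt C)"
    using conics_tangent_atI[OF M(1,2) N(1,2)] M(3,4) N(3,4) by simp_all
qed

section \<open>The interior of the Steiner circumellipse\<close>

text \<open>The form \<open>s\<close> in normalised coordinates is a continuous function on the Euclidean plane, with the
  ellipse as its zero set. It cannot change sign on the component of the complement that contains the
  point, and where it is positive the squares of the coordinates add up to
  \<open>1 - 2 s < 1\<close>, so the component is bounded.\<close>

lemma in_steiner_interior:
  assumes xyz: "x + y + z = 1" and pos: "x * y + y * z + z * x > 0"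
  shows "bar x y z \<in> ellipse_interior (steiner_circumellipse A B C)"
proof -
  obtain T where T: "T ** frame A B C = mat 1" "frame A B C ** T = mat 1" by (rule frame_inverse)
  define co where "co p = T *v lift p" for p
  define s where "s p = co p $ 1 * co p $ 2 + co p $ 2 * co p $ 3 + co p $ 3 * co p $ 1" for p
  define E where "E = pt -` steiner_circumellipse A B C"
  have lift_co: "lift p = comb (co p $ 1) (co p $ 2) (co p $ 3)" for p
    by (simp add: co_def frame_mult[symmetric] matrix_vector_mul_assoc T)
  have sum_co: "co p $ 1 + co p $ 2 + co p $ 3 = 1" for p
    using arg_cong[OF lift_co[of p], of "\<lambda>v. v $ 3"] by simp
  have p_eq: "p = co p $ 1 *\<^sub>R A + co p $ 2 *\<^sub>R B + co p $ 3 *\<^sub>R C" for p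
    using arg_cong[OF lift_co[of p], of "\<lambda>v. v $ 1"] arg_cong[OF lift_co[of p], of "\<lambda>v. v $ 2"]
    by (simp add: vec_eq_iff forall_2)
  have E_iff: "p \<in> E \<longleftrightarrow> s p = 0" for p
  proof -
    have "pt p = bar (co p $ 1) (co p $ 2) (co p $ 3)"
      using pt_bary[OF sum_co[of p]] p_eq[of p] by simp
    moreover have "(co p $ 1, co p $ 2, co p $ 3) \<noteq> (0, 0, 0)" using sum_co[of p] by auto
    ultimately show ?thesis
      using in_steiner_iff[of "co p $ 1" "co p $ 2" "co p $ 3"] unfolding E_def vimage_eq s_def by metis
  qed
  have "continuous_on UNIV (\<lambda>p. lift p $ i)" for i
    using exhaust_3[of i]
    by (elim disjE) (simp_all add: continuous_on_component continuous_on_id continuous_on_const)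
  then have "continuous_on UNIV lift"
    using continuous_on_vec_lambda[of UNIV "\<lambda>i p. lift p $ i"] by simp
  then have "continuous_on UNIV co"
    unfolding co_def by (rule continuous_on_compose2[OF matrix_vector_mult_linear_continuous_on[of UNIV]]) simp
  then have "continuous_on UNIV s"
    unfolding s_def by (intro continuous_intros)
  define p where "p = x *\<^sub>R A + y *\<^sub>R B + z *\<^sub>R C"
  have "comb (co p $ 1) (co p $ 2) (co p $ 3) = comb x y z"
    unfolding lift_co[symmetric] p_def using xyz by (simp add: vec_eq_iff forall_3)
  then have s_p: "s p > 0" using pos by (simp add: comb_eq_iff s_def)
  define K where "K = connected_component_set (- E) p"
  have "p \<in> - E" using s_p E_iff by simp
  then have "p \<in> K" by (simp add: K_def)
  have "K \<subseteq> - E" unfolding K_def by (rule connected_component_subset)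
  have "connected K" by (simp add: K_def)
  then have "connected (s ` K)"
    using \<open>continuous_on UNIV s\<close> by (meson connected_continuous_image continuous_on_subset subset_UNIV)
  have s_pos: "s q > 0" if "q \<in> K" for q
  proof (rule ccontr)
    assume "\<not> s q > 0"
    then have "0 \<in> {s q..s p}" using s_p by simp
    also have "\<dots> \<subseteq> s ` K"
      using \<open>connected (s ` K)\<close> \<open>p \<in> K\<close> \<open>q \<in> K\<close> by (intro connected_contains_Icc) auto
    finally show False using \<open>K \<subseteq> - E\<close> E_iff by auto
  qed
  have "norm q \<le> norm A + norm B + norm C" if "q \<in> K" for q
  proof -
    have "(co q $ 1)\<^sup>2 + (co q $ 2)\<^sup>2 + (co q $ 3)\<^sup>2 = (co q $ 1 + co q $ 2 + co q $ 3)\<^sup>2 - 2 * s q"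
      by (simp add: s_def power2_eq_square algebra_simps)
    then have le1: "(co q $ 1)\<^sup>2 + (co q $ 2)\<^sup>2 + (co q $ 3)\<^sup>2 \<le> 1"
      using s_pos[OF that] by (simp add: sum_co)
    have "\<forall>i. (co q $ i)\<^sup>2 \<le> 1"
      using le1 zero_le_power2[of "co q $ 1"] zero_le_power2[of "co q $ 2"] zero_le_power2[of "co q $ 3"]
      unfolding forall_3 by linarith
    then have "\<bar>co q $ i\<bar> \<le> 1" for i by (simp add: abs_square_le_1)
    then have small: "norm (co q $ i *\<^sub>R v) \<le> norm v" for i and v :: "real^2"
      using mult_right_mono[OF _ norm_ge_zero[of v]] by fastforce
    have "norm q = norm (co q $ 1 *\<^sub>R A + co q $ 2 *\<^sub>R B + co q $ 3 *\<^sub>R C)"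
      using p_eq[of q] by simp
    also have "\<dots> \<le> norm A + norm B + norm C"
      by (intro norm_triangle_mono small)
    finally show ?thesis .
  qed
  then have "bounded K" by (auto simp: bounded_iff)
  then have "p \<in> inside E" using \<open>p \<in> - E\<close> by (simp add: inside_def K_def)
  moreover have "bar x y z = pt p" using pt_bary[OF xyz] by (simp add: p_def)
  ultimately show ?thesis by (simp add: ellipse_interior_def E_def)
qed

lemma apex_conic_interior:
  "apex_conic - {pt B, pt C} \<subseteq> ellipse_interior (steiner_circumellipse A B C)"
proof
  fix P assume P: "P \<in> apex_conic - {pt B, pt C}"
  obtain x y z where xyz: "(x, y, z) \<noteq> (0, 0, 0)" "P = bar x y z" by (rule bary_exists)
  then have e: "x\<^sup>2 = x * y + y * z + z * x" using P in_apex_conic_iff by auto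
  have "x \<noteq> 0"
  proof
    assume "x = 0"
    then have "y = 0 \<or> z = 0" using e by simp
    then have "P = pt B \<or> P = pt C"
      unfolding xyz(2) pt_vertices using \<open>x = 0\<close> xyz(1) by (auto simp: bary_eq_iff)
    then show False using P by blast
  qed
  have "(x + y + z)\<^sup>2 = 3 * x\<^sup>2 + y\<^sup>2 + z\<^sup>2" using e by algebra
  also have "\<dots> > 0" using \<open>x \<noteq> 0\<close> by (intro add_pos_nonneg) auto
  finally have sum: "x + y + z \<noteq> 0" by auto
  then obtain x' y' z' where n: "x' + y' + z' = 1" "x = (x + y + z) * x'" "y = (x + y + z) * y'"
    "z = (x + y + z) * z'" "bar x y z = bar x' y' z'" by (rule affine_bary)
  have "(x', y', z') \<noteq> (0, 0, 0)" using n(1) by auto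
  moreover have "bar x' y' z' \<in> apex_conic" using P xyz(2) n(5) by simp
  ultimately have "x'\<^sup>2 = x' * y' + y' * z' + z' * x'" using in_apex_conic_iff by blast
  moreover have "x' \<noteq> 0" using n(2) \<open>x \<noteq> 0\<close> by auto
  then have "x'\<^sup>2 > 0" by simp
  ultimately have "x' * y' + y' * z' + z' * x' > 0" by simp
  then show "P \<in> ellipse_interior (steiner_circumellipse A B C)"
    unfolding xyz(2) n(5) by (rule in_steiner_interior[OF n(1)])
qed

end

section \<open>The locus of points whose generalized orthocenter is a vertex\<close>

theorem mainTheorem2:
  fixes A B C :: "real^2"
  assumes "\<not> collinear {A, B, C}"
  shows
    "(\<exists>!S. is_vertex_conic A B C S) \<and> (\<exists>!S. is_vertex_conic B C A S) \<and>
     (\<exists>!S. is_vertex_conic C A B S) \<and>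
     {P. has_gen_orthocenter A B C P \<and> gen_orthocenter A B C P \<in> {pt A, pt B, pt C}} =
       (vertex_conic A B C \<union> vertex_conic B C A \<union> vertex_conic C A B)
         - {pt A, pt B, pt C, pt (midpoint B C), pt (midpoint C A), pt (midpoint A B)} \<and>
     conics_tangent_at (vertex_conic A B C) (steiner_circumellipse A B C) (pt B) \<and>
     conics_tangent_at (vertex_conic A B C) (steiner_circumellipse A B C) (pt C) \<and>
     conics_tangent_at (vertex_conic B C A) (steiner_circumellipse A B C) (pt C) \<and>
     conics_tangent_at (vertex_conic B C A) (steiner_circumellipse A B C) (pt A) \<and>
     conics_tangent_at (vertex_conic C A B) (steiner_circumellipse A B C) (pt A) \<and>
     conics_tangent_at (vertex_conic C A B) (steiner_circumellipse A B C) (pt B) \<and>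
     (vertex_conic A B C \<union> vertex_conic B C A \<union> vertex_conic C A B) - {pt A, pt B, pt C}
       \<subseteq> ellipse_interior (steiner_circumellipse A B C)"
proof -
  interpret ABC: triangle A B C using assms by unfold_locales
  interpret BCA: triangle B C A by (rule ABC.triangle_cycle)
  interpret CAB: triangle C A B by (rule BCA.triangle_cycle)
  let ?V = "{pt A, pt B, pt C, pt (midpoint B C), pt (midpoint C A), pt (midpoint A B)}"
  have steiner: "steiner_circumellipse B C A = steiner_circumellipse A B C"
    "steiner_circumellipse C A B = steiner_circumellipse A B C"
    using ABC.steiner_cycle BCA.steiner_cycle by simp_all
  have locus_A: "{P. has_gen_orthocenter A B C P \<and> gen_orthocenter A B C P = pt A} =
      vertex_conic A B C - ?V"
    using ABC.vertex_locus ABC.vertex_conic_eq by simp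
  have "{P. has_gen_orthocenter A B C P \<and> gen_orthocenter A B C P = pt B} =
      {P. has_gen_orthocenter B C A P \<and> gen_orthocenter B C A P = pt B}"
    using ABC.has_gen_orthocenter_cycle ABC.gen_orthocenter_cycle by auto
  also have "\<dots> = vertex_conic B C A - ?V"
    unfolding BCA.vertex_locus BCA.vertex_conic_eq by auto
  finally have locus_B: "{P. has_gen_orthocenter A B C P \<and> gen_orthocenter A B C P = pt B} =
      vertex_conic B C A - ?V" .
  have "{P. has_gen_orthocenter A B C P \<and> gen_orthocenter A B C P = pt C} =
      {P. has_gen_orthocenter C A B P \<and> gen_orthocenter C A B P = pt C}"
    using ABC.has_gen_orthocenter_cycle ABC.gen_orthocenter_cycle
      BCA.has_gen_orthocenter_cycle BCA.gen_orthocenter_cycle by auto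
  also have "\<dots> = vertex_conic C A B - ?V"
    unfolding CAB.vertex_locus CAB.vertex_conic_eq by auto
  finally have locus_C: "{P. has_gen_orthocenter A B C P \<and> gen_orthocenter A B C P = pt C} =
      vertex_conic C A B - ?V" .
  have "{P. has_gen_orthocenter A B C P \<and> gen_orthocenter A B C P \<in> {pt A, pt B, pt C}} =
      {P. has_gen_orthocenter A B C P \<and> gen_orthocenter A B C P = pt A} \<union>
      {P. has_gen_orthocenter A B C P \<and> gen_orthocenter A B C P = pt B} \<union>
      {P. has_gen_orthocenter A B C P \<and> gen_orthocenter A B C P = pt C}" by blast
  also have "\<dots> = (vertex_conic A B C \<union> vertex_conic B C A \<union> vertex_conic C A B) - ?V"
    unfolding locus_A locus_B locus_C by (simp only: Un_Diff)
  finally have locus: "{P. has_gen_orthocenter A B C P \<and> gen_orthocenter A B C P \<in> {pt A, pt B, pt C}} =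
      (vertex_conic A B C \<union> vertex_conic B C A \<union> vertex_conic C A B) - ?V" .
  have interior: "(vertex_conic A B C \<union> vertex_conic B C A \<union> vertex_conic C A B) - {pt A, pt B, pt C}
      \<subseteq> ellipse_interior (steiner_circumellipse A B C)"
    using ABC.apex_conic_interior BCA.apex_conic_interior CAB.apex_conic_interior
    unfolding steiner ABC.vertex_conic_eq BCA.vertex_conic_eq CAB.vertex_conic_eq by blast
  have unique: "\<exists>!S. is_vertex_conic A B C S" "\<exists>!S. is_vertex_conic B C A S" "\<exists>!S. is_vertex_conic C A B S"
    by (simp_all add: ABC.is_vertex_conic_iff BCA.is_vertex_conic_iff CAB.is_vertex_conic_iff)
  show ?thesis
    using unique locus interior ABC.apex_conic_tangent_steiner BCA.apex_conic_tangent_steiner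
      CAB.apex_conic_tangent_steiner
    unfolding steiner ABC.vertex_conic_eq BCA.vertex_conic_eq CAB.vertex_conic_eq
    by (intro conjI)
qed

end
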